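(* Let $n\ge1$, let $a,b\in\mathcal A_n$ be doubly pure with $b\perp \mathrm{Lin}(e_0,a,\tilde e_0,\tilde a)$, and let $a$ alternate strongly with $b$. Put $\mathbb O_{a,b}=\mathrm{Lin}(e_0,a,b,ab,\tilde e_0,\tilde a,\tilde b,\widetilde{ab})$. Then there exists a surjective homomorphism $\phi_{a,b}:\mathcal A_3\{-n(a),-n(b),\gamma_{n-1}\}\to\mathbb O_{a,b}$, so $\mathbb O_{a,b}$ is an alternative subalgebra of $\mathcal A_n$.
   Context: Real Cayley–Dickson algebras: $\mathcal A_0=\mathbb R$ with trivial involution. Given nonzero reals $\gamma_0,\gamma_1,\dots$, the algebra $\mathcal A_{k+1}=\mathcal A_{k+1}\{\gamma_0,\dots,\gamma_k\}$ is $\mathcal A_k\times\mathcal A_k$ with componentwise addition and real scaling, product $(a,b)(c,d)=(ac+\gamma_k\bar d b,\ da+b\bar c)$ and involution $\overline{(a,b)}=(\bar a,-b)$. In the notation $\mathcal A_3\{-n(a),-n(b),\gamma_{n-1}\}$ (same construction with these three parameters) the parameters $-n(a)$, $-n(b)$ are allowed to be zero. Unity: $e_0$. $\mathrm{Re}(a)=\frac{a+\bar a}{2}$, $n(a)=a\bar a\in\mathbb R$, $\langle a,b\rangle=\frac12(a\bar b+b\bar a)$, and $\perp$ means orthogonality with respect to $\langle\cdot,\cdot\rangle$. An element $(a_1,a_2)\in\mathcal A_n$ ($a_1,a_2\in\mathcal A_{n-1}$) is doubly pure if $\mathrm{Re}(a_1)=\mathrm{Re}(a_2)=0$. In $\mathcal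 A_n$, $\tilde e_0=(0,e_0)$ and $\tilde x=x\tilde e_0$. $\mathrm{Lin}$ is the real linear span. Elements $x,y$ alternate strongly if $(xx)y=x(xy)$ and $(yy)x=y(yx)$. *)

theory Defs
  imports Complex_Main "HOL-Library.Function_Algebras"
begin

instantiation "fun" :: (type, real_vector) real_vector
begin

definition scaleR_fun :: "real \<Rightarrow> ('a \<Rightarrow> 'b) \<Rightarrow> 'a \<Rightarrow> 'b"
  where "scaleR_fun r f = (\<lambda>x. r *\<^sub>R f x)"

instance
  by standard (simp_all add: scaleR_fun_def fun_eq_iff scaleR_add_right scaleR_add_left)

end

lemma scaleR_fun_apply [simp]: "(r *\<^sub>R f) x = r *\<^sub>R f x"
  by (simp add: scaleR_fun_def)

text \<open>
  The level of a Cayley-Dickson algebra varies inside the statements, so all levels live in the one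
  real vector space \<^typ>\<open>nat \<Rightarrow> real\<close>, with the pointwise linear structure. It is identified
  with its own square by interleaving: \<open>cd_pair a b\<close> carries \<open>a\<close> on the even and \<open>b\<close> on the odd
  indices. Level 0 is the line of real multiples of \<open>cd_one\<close>, and level \<open>k + 1\<close> is
  the set of all pairs of elements of level \<open>k\<close>; it has dimension \<open>2 ^ (k + 1)\<close>. With this
  encoding the unity \<open>(e\<^sub>0, 0)\<close> of level \<open>k + 1\<close> is the same sequence as the unity of level \<open>k\<close>.
\<close>

type_synonym cd = "nat \<Rightarrow> real"

definition cd_pair :: "cd \<Rightarrow> cd \<Rightarrow> cd" where
  "cd_pair a b = (\<lambda>i. if even i then a (i div 2) else b (i div 2))"

definition cd_fst :: "cd \<Rightarrow> cd" where
  "cd_fst x = (\<lambda>i. x (2 * i))"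

definition cd_snd :: "cd \<Rightarrow> cd" where
  "cd_snd x = (\<lambda>i. x (2 * i + 1))"

lemma cd_fst_pair [simp]: "cd_fst (cd_pair a b) = a"
  by (simp add: cd_fst_def cd_pair_def)

lemma cd_snd_pair [simp]: "cd_snd (cd_pair a b) = b"
  by (simp add: cd_snd_def cd_pair_def)

lemma cd_pair_collapse [simp]: "cd_pair (cd_fst x) (cd_snd x) = x"
  by (auto simp: cd_fst_def cd_snd_def cd_pair_def fun_eq_iff)

lemma cd_pair_eq_iff [simp]: "cd_pair a b = cd_pair c d \<longleftrightarrow> a = c \<and> b = d"
  by (metis cd_fst_pair cd_snd_pair)

lemma cd_pair_add: "cd_pair a b + cd_pair c d = cd_pair (a + c) (b + d)"
  by (auto simp: cd_pair_def fun_eq_iff)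

lemma cd_pair_scaleR: "r *\<^sub>R cd_pair a b = cd_pair (r *\<^sub>R a) (r *\<^sub>R b)"
  by (auto simp: cd_pair_def fun_eq_iff)

definition cd_one :: cd where
  "cd_one = (\<lambda>i. if i = 0 then 1 else 0)"

lemma cd_one_pair: "cd_one = cd_pair cd_one 0"
  by (auto simp: cd_one_def cd_pair_def fun_eq_iff elim: evenE)

fun cd_carrier :: "nat \<Rightarrow> cd set" where
  "cd_carrier 0 = range (\<lambda>r. r *\<^sub>R cd_one)"
| "cd_carrier (Suc k) = {cd_pair a b |a b. a \<in> cd_carrier k \<and> b \<in> cd_carrier k}"

fun cd_conj :: "nat \<Rightarrow> cd \<Rightarrow> cd" where
  "cd_conj 0 x = x"
| "cd_conj (Suc k) x = cd_pair (cd_conj k (cd_fst x)) (- cd_snd x)"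

text \<open>
  \<open>cd_mult \<gamma> k\<close> is the product of the algebra of level \<open>k\<close> with parameters
  \<open>\<gamma> 0, \<dots>, \<gamma> (k - 1)\<close>, which may be zero here.
\<close>

fun cd_mult :: "(nat \<Rightarrow> real) \<Rightarrow> nat \<Rightarrow> cd \<Rightarrow> cd \<Rightarrow> cd" where
  "cd_mult \<gamma> 0 x y = (x 0 * y 0) *\<^sub>R cd_one"
| "cd_mult \<gamma> (Suc k) x y =
     (let a = cd_fst x; b = cd_snd x; c = cd_fst y; d = cd_snd y in
      cd_pair (cd_mult \<gamma> k a c + \<gamma> k *\<^sub>R cd_mult \<gamma> k (cd_conj k d) b)
              (cd_mult \<gamma> k d a + cd_mult \<gamma> k b (cd_conj k c)))"

definition cd_Re :: "nat \<Rightarrow> cd \<Rightarrow> cd" where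
  "cd_Re n x = (1 / 2) *\<^sub>R (x + cd_conj n x)"

definition cd_inner :: "(nat \<Rightarrow> real) \<Rightarrow> nat \<Rightarrow> cd \<Rightarrow> cd \<Rightarrow> cd" where
  "cd_inner \<gamma> n x y =
     (1 / 2) *\<^sub>R (cd_mult \<gamma> n x (cd_conj n y) + cd_mult \<gamma> n y (cd_conj n x))"

text \<open>
  The norm is the real number \<open>r\<close> with \<open>x \<cdot> conj x = r e\<^sub>0\<close>, that is, the coordinate
  of that product at \<open>e\<^sub>0\<close>; see \<open>cd_mult_conj\<close> below.
\<close>

definition cd_n :: "(nat \<Rightarrow> real) \<Rightarrow> nat \<Rightarrow> cd \<Rightarrow> real" where
  "cd_n \<gamma> n x = cd_mult \<gamma> n x (cd_conj n x) 0"

definition cd_doubly_pure :: "nat \<Rightarrow> cd \<Rightarrow> bool" where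
  "cd_doubly_pure n x \<longleftrightarrow>
     (\<exists>a1 \<in> cd_carrier (n - 1). \<exists>a2 \<in> cd_carrier (n - 1).
        x = cd_pair a1 a2 \<and> cd_Re (n - 1) a1 = 0 \<and> cd_Re (n - 1) a2 = 0)"

definition cd_tilde_one :: cd where
  "cd_tilde_one = cd_pair 0 cd_one"

definition cd_tilde :: "(nat \<Rightarrow> real) \<Rightarrow> nat \<Rightarrow> cd \<Rightarrow> cd" where
  "cd_tilde \<gamma> n x = cd_mult \<gamma> n x cd_tilde_one"

definition alternate_strongly :: "(nat \<Rightarrow> real) \<Rightarrow> nat \<Rightarrow> cd \<Rightarrow> cd \<Rightarrow> bool" where
  "alternate_strongly \<gamma> n x y \<longleftrightarrow>
     cd_mult \<gamma> n (cd_mult \<gamma> n x x) y = cd_mult \<gamma> n x (cd_mult \<gamma> n x y) \<and>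
     cd_mult \<gamma> n (cd_mult \<gamma> n y y) x = cd_mult \<gamma> n y (cd_mult \<gamma> n y x)"

definition cd_subalgebra :: "(nat \<Rightarrow> real) \<Rightarrow> nat \<Rightarrow> cd set \<Rightarrow> bool" where
  "cd_subalgebra \<gamma> n S \<longleftrightarrow>
     S \<subseteq> cd_carrier n \<and> subspace S \<and> cd_one \<in> S \<and> (\<forall>x\<in>S. \<forall>y\<in>S. cd_mult \<gamma> n x y \<in> S)"

definition cd_alternative_on :: "(nat \<Rightarrow> real) \<Rightarrow> nat \<Rightarrow> cd set \<Rightarrow> bool" where
  "cd_alternative_on \<gamma> n S \<longleftrightarrow>
     (\<forall>x\<in>S. \<forall>y\<in>S.
        cd_mult \<gamma> n (cd_mult \<gamma> n x x) y = cd_mult \<gamma> n x (cd_mult \<gamma> n x y) \<and>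
        cd_mult \<gamma> n (cd_mult \<gamma> n y x) x = cd_mult \<gamma> n y (cd_mult \<gamma> n x x))"

text \<open>
  Homomorphisms of unital real algebras from level \<open>m\<close> with parameters \<open>\<delta>\<close> to level \<open>n\<close> with
  parameters \<open>\<gamma>\<close>; the values of \<open>\<phi>\<close> outside \<open>cd_carrier m\<close> are irrelevant.
\<close>

definition cd_hom ::
  "(nat \<Rightarrow> real) \<Rightarrow> nat \<Rightarrow> (nat \<Rightarrow> real) \<Rightarrow> nat \<Rightarrow> (cd \<Rightarrow> cd) \<Rightarrow> bool" where
  "cd_hom \<delta> m \<gamma> n \<phi> \<longleftrightarrow>
     \<phi> ` cd_carrier m \<subseteq> cd_carrier n \<and>
     \<phi> cd_one = cd_one \<and>
     (\<forall>x\<in>cd_carrier m. \<forall>y\<in>cd_carrier m. \<phi> (x + y) = \<phi> x + \<phi> y) \<and>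
     (\<forall>r. \<forall>x\<in>cd_carrier m. \<phi> (r *\<^sub>R x) = r *\<^sub>R \<phi> x) \<and>
     (\<forall>x\<in>cd_carrier m. \<forall>y\<in>cd_carrier m. \<phi> (cd_mult \<delta> m x y) = cd_mult \<gamma> n (\<phi> x) (\<phi> y))"

definition cd_O :: "(nat \<Rightarrow> real) \<Rightarrow> nat \<Rightarrow> cd \<Rightarrow> cd \<Rightarrow> cd set" where
  "cd_O \<gamma> n a b =
     span {cd_one, a, b, cd_mult \<gamma> n a b,
           cd_tilde_one, cd_tilde \<gamma> n a, cd_tilde \<gamma> n b, cd_tilde \<gamma> n (cd_mult \<gamma> n a b)}"

lemma cd_mult_pair:
  "cd_mult \<gamma> (Suc k) (cd_pair a b) (cd_pair c d) =
     cd_pair (cd_mult \<gamma> k a c + \<gamma> k *\<^sub>R cd_mult \<gamma> k (cd_conj k d) b)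
             (cd_mult \<gamma> k d a + cd_mult \<gamma> k b (cd_conj k c))"
  by simp

lemma cd_conj_pair: "cd_conj (Suc k) (cd_pair a b) = cd_pair (cd_conj k a) (- b)"
  by simp

lemma cd_conj_conj [simp]: "cd_conj k (cd_conj k x) = x"
  by (induction k arbitrary: x) simp_all

lemma cd_fst_linear [simp]:
  "cd_fst (x + y) = cd_fst x + cd_fst y" "cd_fst (r *\<^sub>R x) = r *\<^sub>R cd_fst x" "cd_fst (- x) = - cd_fst x"
  by (auto simp: cd_fst_def fun_eq_iff)

lemma cd_snd_linear [simp]:
  "cd_snd (x + y) = cd_snd x + cd_snd y" "cd_snd (r *\<^sub>R x) = r *\<^sub>R cd_snd x" "cd_snd (- x) = - cd_snd x"
  by (auto simp: cd_snd_def fun_eq_iff)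

lemma cd_pair_minus: "- cd_pair a b = cd_pair (- a) (- b)"
  by (auto simp: cd_pair_def fun_eq_iff)

lemma cd_conj_minus: "cd_conj k (- x) = - cd_conj k x"
  by (induction k arbitrary: x) (simp_all add: cd_pair_minus)

lemma cd_mult_minus:
  "cd_mult \<gamma> k (- x) y = - cd_mult \<gamma> k x y \<and> cd_mult \<gamma> k x (- y) = - cd_mult \<gamma> k x y"
  by (induction k arbitrary: x y)
     (simp_all add: Let_def cd_pair_minus cd_conj_minus)

lemma cd_mult_conj_aux:
  "\<exists>r. cd_mult \<gamma> k x (cd_conj k x) = r *\<^sub>R cd_one \<and> cd_mult \<gamma> k (cd_conj k x) x = r *\<^sub>R cd_one"
proof (induction k arbitrary: x)
  case 0
  show ?case by auto
next
  case (Suc k)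
  obtain r s where
    "cd_mult \<gamma> k (cd_fst x) (cd_conj k (cd_fst x)) = r *\<^sub>R cd_one"
    "cd_mult \<gamma> k (cd_conj k (cd_fst x)) (cd_fst x) = r *\<^sub>R cd_one"
    "cd_mult \<gamma> k (cd_conj k (cd_snd x)) (cd_snd x) = s *\<^sub>R cd_one"
    using Suc.IH by meson
  moreover have "t *\<^sub>R cd_one = cd_pair (t *\<^sub>R cd_one) 0" for t
    by (subst (1) cd_one_pair) (simp add: cd_pair_scaleR)
  then have "(r - \<gamma> k * s) *\<^sub>R cd_one = cd_pair (r *\<^sub>R cd_one - (\<gamma> k * s) *\<^sub>R cd_one) 0"
    by (metis scaleR_left_diff_distrib)
  ultimately show ?case
    by (intro exI[of _ "r - \<gamma> k * s"]) (simp only:, simp add: Let_def cd_mult_minus cd_conj_minus)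
qed

lemma cd_mult_conj: "cd_mult \<gamma> n x (cd_conj n x) = cd_n \<gamma> n x *\<^sub>R cd_one"
  using cd_mult_conj_aux[of \<gamma> n x] by (auto simp: cd_n_def cd_one_def)

end

theory Submission
  imports Defs
begin

text \<open>
  The map is built by three doublings. Let \<open>\<psi>\<close> be a homomorphism of algebras with involution from level
  \<open>k\<close> to \<open>\<A>\<^sub>n\<close> with image \<open>S\<close>. If \<open>x(ye) = (yx)e\<close>, \<open>(xe)y = (x\<cdot>conj y)e\<close>,
  \<open>(xe)(ye) = \<delta>\<^sub>k (conj y)x\<close> and \<open>conj (xe) = -xe\<close> on \<open>S\<close>, then \<open>(u, v) \<mapsto> \<psi> u + (\<psi> v)e\<close> is again such a
  homomorphism. For \<open>e = a\<close> and \<open>e = b\<close> the conditions come from the multiplication table of \<open>1, a, b, ab\<close>.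
  For the last step, \<open>e = (0, 1)\<close>, they hold for all \<open>x, y\<close> such that \<open>x\<close>, \<open>y\<close> and \<open>xy\<close> have pure second
  components, and the orthogonality of \<open>b\<close> to \<open>a(0, 1)\<close> says exactly that the second component of \<open>ab\<close> is pure.
  The real part \<open>x 0\<close> is a trace: \<open>xy\<close> and \<open>yx\<close>, and \<open>(xy)z\<close> and \<open>x(yz)\<close>, have equal real parts.
  Finally, level 3 is alternative because level 2 is associative, also for zero parameters.
\<close>

text \<open>As simp rules these also rewrite eta-expanded sequences, so they are kept for evaluation at 0 only.\<close>

declare plus_fun_apply [simp del] zero_fun_apply [simp del] uminus_apply [simp del]
  minus_apply [simp del] scaleR_fun_apply [simp del]

lemmas cd_apply = plus_fun_apply zero_fun_apply uminus_apply minus_apply scaleR_fun_apply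

section \<open>Coordinate 0, components, and linearity of conjugation and product\<close>

lemma cd_at_0 [simp]:
  fixes x y :: cd
  shows "(x + y) 0 = x 0 + y 0" "(0 :: cd) 0 = 0" "(- x) 0 = - x 0" "(x - y) 0 = x 0 - y 0"
    "(r *\<^sub>R x) 0 = r * x 0"
  by (simp_all add: cd_apply)

lemma cd_fst_zero [simp]: "cd_fst 0 = 0" and cd_snd_zero [simp]: "cd_snd 0 = 0"
  by (auto simp: cd_fst_def cd_snd_def cd_apply fun_eq_iff)

lemma cd_pair_zero [simp]: "cd_pair 0 0 = 0"
  by (auto simp: cd_pair_def cd_apply fun_eq_iff)

lemma cd_pair_at_0 [simp]: "cd_pair x y 0 = x 0"
  by (simp add: cd_pair_def)

lemma cd_one_at_0 [simp]: "cd_one 0 = 1"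
  by (simp add: cd_one_def)

lemma cd_fst_one [simp]: "cd_fst cd_one = cd_one" and cd_snd_one [simp]: "cd_snd cd_one = 0"
  using cd_one_pair by (metis cd_fst_pair, metis cd_snd_pair)

lemma cd_fst_at_0 [simp]: "cd_fst x 0 = x 0"
  by (simp add: cd_fst_def)

lemma cd_conj_add: "cd_conj k (x + y) = cd_conj k x + cd_conj k y"
  by (induction k arbitrary: x y) (simp_all add: cd_pair_add)

lemma cd_conj_scaleR: "cd_conj k (r *\<^sub>R x) = r *\<^sub>R cd_conj k x"
  by (induction k arbitrary: x) (simp_all add: cd_pair_scaleR)

lemma cd_conj_zero [simp]: "cd_conj k 0 = 0"
  using cd_conj_scaleR[of k 0] by simp

lemma cd_conj_one [simp]: "cd_conj k cd_one = cd_one"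
  by (induction k) (simp_all flip: cd_one_pair)

lemma cd_conj_at_0 [simp]: "cd_conj k x 0 = x 0"
  by (induction k arbitrary: x) simp_all

lemma cd_mult_add_left: "cd_mult \<gamma> k (x + y) z = cd_mult \<gamma> k x z + cd_mult \<gamma> k y z"
  and cd_mult_add_right: "cd_mult \<gamma> k z (x + y) = cd_mult \<gamma> k z x + cd_mult \<gamma> k z y"
proof -
  have "cd_mult \<gamma> k (x + y) z = cd_mult \<gamma> k x z + cd_mult \<gamma> k y z \<and>
        cd_mult \<gamma> k z (x + y) = cd_mult \<gamma> k z x + cd_mult \<gamma> k z y"
    by (induction k arbitrary: x y z)
       (simp_all add: Let_def cd_pair_add cd_conj_add algebra_simps)
  then show "cd_mult \<gamma> k (x + y) z = cd_mult \<gamma> k x z + cd_mult \<gamma> k y z"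
    "cd_mult \<gamma> k z (x + y) = cd_mult \<gamma> k z x + cd_mult \<gamma> k z y" by auto
qed

lemma cd_mult_scaleR_left: "cd_mult \<gamma> k (r *\<^sub>R x) z = r *\<^sub>R cd_mult \<gamma> k x z"
  and cd_mult_scaleR_right: "cd_mult \<gamma> k z (r *\<^sub>R x) = r *\<^sub>R cd_mult \<gamma> k z x"
proof -
  have "cd_mult \<gamma> k (r *\<^sub>R x) z = r *\<^sub>R cd_mult \<gamma> k x z \<and>
        cd_mult \<gamma> k z (r *\<^sub>R x) = r *\<^sub>R cd_mult \<gamma> k z x"
    by (induction k arbitrary: x z)
       (simp_all add: Let_def cd_pair_scaleR cd_conj_scaleR algebra_simps)
  then show "cd_mult \<gamma> k (r *\<^sub>R x) z = r *\<^sub>R cd_mult \<gamma> k x z"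
    "cd_mult \<gamma> k z (r *\<^sub>R x) = r *\<^sub>R cd_mult \<gamma> k z x" by auto
qed

lemma cd_mult_zero [simp]: "cd_mult \<gamma> k 0 x = 0" "cd_mult \<gamma> k x 0 = 0"
  using cd_mult_scaleR_left[of \<gamma> k 0] cd_mult_scaleR_right[of \<gamma> k x 0] by simp_all

lemma cd_mult_diff_left: "cd_mult \<gamma> k (x - y) z = cd_mult \<gamma> k x z - cd_mult \<gamma> k y z"
  and cd_mult_diff_right: "cd_mult \<gamma> k z (x - y) = cd_mult \<gamma> k z x - cd_mult \<gamma> k z y"
  by (simp_all only: diff_conv_add_uminus cd_mult_add_left cd_mult_add_right cd_mult_minus)

lemmas cd_linear = cd_conj_add cd_conj_scaleR cd_conj_minus cd_mult_add_left cd_mult_add_right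
  cd_mult_scaleR_left cd_mult_scaleR_right cd_mult_minus

lemma cd_conj_mult: "cd_conj k (cd_mult \<gamma> k x y) = cd_mult \<gamma> k (cd_conj k y) (cd_conj k x)"
  by (induction k arbitrary: x y) (simp_all add: Let_def cd_linear cd_pair_add mult.commute)

section \<open>Closure of the levels under the operations, and the unit\<close>

lemma cd_carrier_Suc_iff: "x \<in> cd_carrier (Suc k) \<longleftrightarrow> cd_fst x \<in> cd_carrier k \<and> cd_snd x \<in> cd_carrier k"
  by (auto, metis cd_pair_collapse)

lemma cd_zero_carrier: "0 \<in> cd_carrier k"
proof (induction k)
  case 0
  show ?case using rangeI[of "\<lambda>r. r *\<^sub>R cd_one" 0] by (simp only: cd_carrier.simps scaleR_zero_left)
qed (simp add: cd_carrier_Suc_iff del: cd_carrier.simps)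

lemma cd_carrier_add: "x \<in> cd_carrier k \<Longrightarrow> y \<in> cd_carrier k \<Longrightarrow> x + y \<in> cd_carrier k"
proof (induction k arbitrary: x y)
  case 0
  then obtain r s where "x = r *\<^sub>R cd_one" "y = s *\<^sub>R cd_one"
    unfolding cd_carrier.simps by blast
  then show ?case
    unfolding cd_carrier.simps by (simp only: scaleR_add_left[symmetric]) (rule rangeI)
qed (simp add: cd_carrier_Suc_iff del: cd_carrier.simps)

lemma cd_carrier_scaleR: "x \<in> cd_carrier k \<Longrightarrow> r *\<^sub>R x \<in> cd_carrier k"
proof (induction k arbitrary: x)
  case 0
  then obtain s where "x = s *\<^sub>R cd_one"
    unfolding cd_carrier.simps by blast
  then show ?case
    unfolding cd_carrier.simps by (simp only: scaleR_scaleR) (rule rangeI)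
qed (simp add: cd_carrier_Suc_iff del: cd_carrier.simps)

lemma cd_carrier_minus: "x \<in> cd_carrier k \<Longrightarrow> - x \<in> cd_carrier k"
  using cd_carrier_scaleR[of x k "-1"] by simp

lemma cd_one_carrier: "cd_one \<in> cd_carrier k"
proof (induction k)
  case 0
  show ?case using rangeI[of "\<lambda>r. r *\<^sub>R cd_one" 1] by (simp only: cd_carrier.simps scaleR_one)
qed (simp add: cd_carrier_Suc_iff cd_zero_carrier del: cd_carrier.simps)

lemma cd_conj_carrier: "x \<in> cd_carrier k \<Longrightarrow> cd_conj k x \<in> cd_carrier k"
  by (induction k arbitrary: x)
     (auto simp: cd_carrier_Suc_iff cd_carrier_minus simp del: cd_carrier.simps)

lemma cd_mult_carrier:
  "x \<in> cd_carrier k \<Longrightarrow> y \<in> cd_carrier k \<Longrightarrow> cd_mult \<gamma> k x y \<in> cd_carrier k"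
proof (induction k arbitrary: x y)
  case 0
  show ?case unfolding cd_carrier.simps cd_mult.simps by (rule rangeI)
qed (simp add: cd_carrier_Suc_iff Let_def cd_carrier_add cd_carrier_scaleR cd_conj_carrier
       del: cd_carrier.simps)

lemma cd_mult_one:
  assumes "x \<in> cd_carrier k"
  shows "cd_mult \<gamma> k cd_one x = x" "cd_mult \<gamma> k x cd_one = x"
proof -
  have "cd_mult \<gamma> k cd_one x = x \<and> cd_mult \<gamma> k x cd_one = x"
    using assms
  proof (induction k arbitrary: x)
    case 0
    then show ?case by auto
  qed (simp add: cd_carrier_Suc_iff Let_def del: cd_carrier.simps)
  then show "cd_mult \<gamma> k cd_one x = x" "cd_mult \<gamma> k x cd_one = x" by auto
qed

section \<open>The real part as a trace\<close>

text \<open>Second components cancel in the sum, so the induction follows first components down to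
  level 0. This makes \<open>x 0\<close> the real part, and purity becomes a condition on one
  coordinate.\<close>

lemma cd_add_conj: "x \<in> cd_carrier k \<Longrightarrow> x + cd_conj k x = (2 * x 0) *\<^sub>R cd_one"
proof (induction k arbitrary: x)
  case 0
  then obtain r where "x = r *\<^sub>R cd_one"
    unfolding cd_carrier.simps by blast
  then show ?case
    by (simp only: cd_conj.simps cd_at_0 cd_one_at_0 mult_1_right scaleR_scaleR[symmetric] scaleR_2)
next
  case (Suc k)
  have "x + cd_conj (Suc k) x = cd_pair (cd_fst x + cd_conj k (cd_fst x)) 0"
    by (metis cd_pair_collapse cd_conj_pair cd_pair_add add.right_inverse)
  also have "cd_fst x + cd_conj k (cd_fst x) = (2 * x 0) *\<^sub>R cd_one"
    using Suc.IH[of "cd_fst x"] Suc.prems by (simp only: cd_carrier_Suc_iff cd_fst_at_0)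
  also have "cd_pair ((2 * x 0) *\<^sub>R cd_one) 0 = (2 * x 0) *\<^sub>R cd_pair cd_one 0"
    by (simp add: cd_pair_scaleR)
  finally show ?case by (simp flip: cd_one_pair)
qed

lemma cd_conj_pure: "x \<in> cd_carrier k \<Longrightarrow> x 0 = 0 \<Longrightarrow> cd_conj k x = - x"
  using cd_add_conj[of x k] by (simp add: eq_neg_iff_add_eq_0 add.commute)

lemma cd_mult_at_0_commute: "cd_mult \<gamma> k x y 0 = cd_mult \<gamma> k y x 0"
proof (induction k arbitrary: x y)
  case (Suc k)
  \<comment> \<open>Conjugation reverses products and keeps coordinate 0, so the term with factor
    \<open>\<gamma> k\<close> is symmetric as well.\<close>
  have "cd_mult \<gamma> k (cd_conj k d) b 0 = cd_mult \<gamma> k (cd_conj k b) d 0" for b d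
    by (metis cd_conj_at_0 cd_conj_conj cd_conj_mult)
  then show ?case
    using Suc by (simp add: Let_def)
qed simp

text \<open>At the next level each side has four summands. One pair is the induction hypothesis
  itself; the other three agree up to a cyclic permutation of factors, which follows from the
  hypothesis and \<open>cd_mult_at_0_commute\<close>.\<close>

lemma cd_mult_at_0_assoc:
  "cd_mult \<gamma> k (cd_mult \<gamma> k x y) z 0 = cd_mult \<gamma> k x (cd_mult \<gamma> k y z) 0"
proof (induction k arbitrary: x y z)
  case (Suc k)
  let ?m = "cd_mult \<gamma> k" and ?c = "cd_conj k"
  have *: "?m (?m x y) z 0 = ?m y (?m z x) 0" for x y z
    by (metis Suc cd_mult_at_0_commute)
  have **: "?m x (?m y z) 0 = ?m y (?m z x) 0" for x y z
    by (metis * Suc)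
  define a b c d e f where d: "a = cd_fst x" "b = cd_snd x" "c = cd_fst y" "d = cd_snd y"
    "e = cd_fst z" "f = cd_snd z"
  have 1: "?m (?m (?c d) b) e 0 = ?m (?m e (?c d)) b 0"
    by (metis * **)
  have 2: "?m (?c f) (?m d a) 0 = ?m a (?m (?c f) d) 0"
    by (metis **)
  have 3: "?m (?c f) (?m b (?c c)) 0 = ?m (?m (?c c) (?c f)) b 0"
    by (metis * **)
  show ?case
    using 1 2 3 Suc[of a c e]
    by (simp add: Let_def cd_linear cd_conj_mult d[symmetric] distrib_left)
qed simp

lemma cd_mult_self_pure: "cd_conj k x = - x \<Longrightarrow> cd_mult \<gamma> k x x = - cd_n \<gamma> k x *\<^sub>R cd_one"
  using cd_mult_conj[of \<gamma> k x] by (simp add: cd_mult_minus) (metis minus_minus)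

section \<open>Associativity and alternativity at low levels\<close>

lemma cd_mult_commute_level_0: "cd_mult \<gamma> 0 x y = cd_mult \<gamma> 0 y x"
  by (simp add: mult.commute)

text \<open>The involution of level 0 is the identity, which makes the doubled product
  symmetric.\<close>

lemma cd_mult_commute_level_1: "cd_mult \<gamma> (Suc 0) x y = cd_mult \<gamma> (Suc 0) y x"
  by (simp add: Let_def mult.commute add.commute)

lemma cd_mult_assoc_level_0: "cd_mult \<gamma> 0 (cd_mult \<gamma> 0 x y) z = cd_mult \<gamma> 0 x (cd_mult \<gamma> 0 y z)"
  by simp

lemma cd_mult_assoc_Suc:
  assumes assoc: "\<And>x y z. cd_mult \<gamma> k (cd_mult \<gamma> k x y) z = cd_mult \<gamma> k x (cd_mult \<gamma> k y z)"
    and comm: "\<And>x y. cd_mult \<gamma> k x y = cd_mult \<gamma> k y x"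
  shows "cd_mult \<gamma> (Suc k) (cd_mult \<gamma> (Suc k) x y) z = cd_mult \<gamma> (Suc k) x (cd_mult \<gamma> (Suc k) y z)"
proof -
  have "cd_mult \<gamma> k x (cd_mult \<gamma> k y z) = cd_mult \<gamma> k y (cd_mult \<gamma> k x z)" for x y z
    by (metis assoc comm)
  then show ?thesis
    by (simp add: Let_def cd_linear cd_conj_mult assoc comm scaleR_add_right add_ac)
qed

lemma cd_mult_assoc_level_2:
  "cd_mult \<gamma> (Suc (Suc 0)) (cd_mult \<gamma> (Suc (Suc 0)) x y) z =
   cd_mult \<gamma> (Suc (Suc 0)) x (cd_mult \<gamma> (Suc (Suc 0)) y z)"
  by (intro cd_mult_assoc_Suc cd_mult_assoc_level_0 cd_mult_commute_level_0 cd_mult_commute_level_1)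

text \<open>Left multiplication by the conjugate of \<open>x\<close> undoes left multiplication by
  \<open>x\<close> up to the norm, and \<open>x\<close> plus its conjugate is scalar. The norm is
  never divided by, so degenerate parameters are covered.\<close>

lemma cd_alternative_on_Suc:
  assumes assoc: "\<And>x y z. cd_mult \<gamma> k (cd_mult \<gamma> k x y) z = cd_mult \<gamma> k x (cd_mult \<gamma> k y z)"
  shows "cd_alternative_on \<gamma> (Suc k) (cd_carrier (Suc k))"
proof -
  let ?m = "cd_mult \<gamma> (Suc k)" and ?c = "cd_conj (Suc k)"
  \<comment> \<open>\<open>N\<close> is the norm of \<open>x\<close>. In components the mixed terms
    cancel, and associativity at level \<open>k\<close> brings \<open>p\<close> and \<open>q\<close>
    next to their conjugates.\<close>
  have inv: "\<exists>N. \<forall>y \<in> cd_carrier (Suc k). ?m (?c x) (?m x y) = N *\<^sub>R y" for x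
  proof -
    define p q where pq: "p = cd_fst x" "q = cd_snd x"
    obtain r s where r: "cd_mult \<gamma> k p (cd_conj k p) = r *\<^sub>R cd_one"
      "cd_mult \<gamma> k (cd_conj k p) p = r *\<^sub>R cd_one"
      and s: "cd_mult \<gamma> k q (cd_conj k q) = s *\<^sub>R cd_one"
      "cd_mult \<gamma> k (cd_conj k q) q = s *\<^sub>R cd_one"
      using cd_mult_conj_aux by meson
    have r': "cd_mult \<gamma> k (cd_conj k p) (cd_mult \<gamma> k p z) = r *\<^sub>R z"
      and s': "cd_mult \<gamma> k q (cd_mult \<gamma> k (cd_conj k q) z) = s *\<^sub>R z" if "z \<in> cd_carrier k" for z
      by (simp_all only: assoc[symmetric] r s cd_mult_scaleR_left cd_mult_one(1)[OF that])
    have "?m (?c x) (?m x y) = (r - \<gamma> k * s) *\<^sub>R y" if y: "y \<in> cd_carrier (Suc k)" for y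
    proof -
      have y': "cd_fst y \<in> cd_carrier k" "cd_snd y \<in> cd_carrier k"
        using y by (simp_all add: cd_carrier_Suc_iff del: cd_carrier.simps)
      have "?m (?c x) (?m x y) = cd_pair ((r - \<gamma> k * s) *\<^sub>R cd_fst y) ((r - \<gamma> k * s) *\<^sub>R cd_snd y)"
        using y' by (simp add: Let_def pq[symmetric] cd_linear cd_conj_mult assoc r r' s s'
            cd_mult_one scaleR_add_right scaleR_diff_left)
      then show ?thesis by (simp flip: cd_pair_scaleR)
    qed
    then show ?thesis by blast
  qed
  have left: "?m (?m x x) y = ?m x (?m x y)"
    if x: "x \<in> cd_carrier (Suc k)" and y: "y \<in> cd_carrier (Suc k)" for x y
  proof -
    obtain N where N: "\<And>y. y \<in> cd_carrier (Suc k) \<Longrightarrow> ?m (?c x) (?m x y) = N *\<^sub>R y"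
      using inv[of x] by blast
    have norm: "?m (?c x) x = N *\<^sub>R cd_one"
      using N[OF cd_one_carrier] by (simp only: cd_mult_one(2)[OF x])
    \<comment> \<open>Writing \<open>x\<close> as twice its real part minus its conjugate turns both
      \<open>(xx)y\<close> and \<open>x(xy)\<close> into \<open>(2 * x 0)\<close> times
      \<open>xy\<close> minus \<open>N\<close> times \<open>y\<close>.\<close>
    have reflect: "?m x z = (2 * x 0) *\<^sub>R z - ?m (?c x) z" if "z \<in> cd_carrier (Suc k)" for z
    proof -
      have "?m (x + ?c x) z = (2 * x 0) *\<^sub>R z"
        by (simp only: cd_add_conj[OF x] cd_mult_scaleR_left cd_mult_one(1)[OF that])
      then show ?thesis by (simp only: cd_mult_add_left eq_diff_eq)
    qed
    show ?thesis
      by (simp only: reflect[OF x] norm reflect[OF cd_mult_carrier[OF x y]] N[OF y] cd_mult_diff_left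
          cd_mult_scaleR_left cd_mult_one(1)[OF y])
  qed
  \<comment> \<open>The right law is the conjugate of the left law.\<close>
  have "?m (?m y x) x = ?m y (?m x x)"
    if "x \<in> cd_carrier (Suc k)" and "y \<in> cd_carrier (Suc k)" for x y
    using left[of "?c x" "?c y"] that cd_conj_carrier
    by (metis cd_conj_conj cd_conj_mult)
  with left show ?thesis
    unfolding cd_alternative_on_def by blast
qed

lemma cd_alternative_on_level_3: "cd_alternative_on \<gamma> 3 (cd_carrier 3)"
  unfolding numeral_3_eq_3 by (intro cd_alternative_on_Suc cd_mult_assoc_level_2)

section \<open>Images of homomorphisms\<close>

lemma cd_hom_image_subalgebra:
  assumes "cd_hom \<delta> m \<gamma> n \<phi>"
  shows "cd_subalgebra \<gamma> n (\<phi> ` cd_carrier m)"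
proof -
  have add: "\<phi> x + \<phi> y = \<phi> (x + y)" and mult: "cd_mult \<gamma> n (\<phi> x) (\<phi> y) = \<phi> (cd_mult \<delta> m x y)"
    and scaleR: "r *\<^sub>R \<phi> x = \<phi> (r *\<^sub>R x)" if "x \<in> cd_carrier m" "y \<in> cd_carrier m" for x y r
    using assms that by (auto simp: cd_hom_def)
  have "\<phi> 0 = 0"
    using scaleR[OF cd_zero_carrier cd_zero_carrier, of 0] by simp
  then have "0 \<in> \<phi> ` cd_carrier m"
    using cd_zero_carrier by (intro image_eqI[of _ _ 0]) simp_all
  then have "subspace (\<phi> ` cd_carrier m)"
    by (auto simp: subspace_def add scaleR cd_carrier_add cd_carrier_scaleR)
  moreover have "\<phi> ` cd_carrier m \<subseteq> cd_carrier n" "cd_one \<in> \<phi> ` cd_carrier m"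
    using assms image_eqI[OF _ cd_one_carrier, of cd_one \<phi> m] by (auto simp: cd_hom_def)
  moreover have "\<forall>x\<in>\<phi> ` cd_carrier m. \<forall>y\<in>\<phi> ` cd_carrier m. cd_mult \<gamma> n x y \<in> \<phi> ` cd_carrier m"
    by (auto simp: mult cd_mult_carrier)
  ultimately show ?thesis
    unfolding cd_subalgebra_def by blast
qed

lemma cd_hom_image_alternative:
  assumes "cd_hom \<delta> m \<gamma> n \<phi>" "cd_alternative_on \<delta> m (cd_carrier m)"
  shows "cd_alternative_on \<gamma> n (\<phi> ` cd_carrier m)"
proof -
  have mult: "cd_mult \<gamma> n (\<phi> x) (\<phi> y) = \<phi> (cd_mult \<delta> m x y)"
    if "x \<in> cd_carrier m" "y \<in> cd_carrier m" for x y
    using assms that by (auto simp: cd_hom_def)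
  show ?thesis
    using assms(2) by (simp add: cd_alternative_on_def mult cd_mult_carrier)
qed

section \<open>Doubling a homomorphism\<close>

text \<open>The doubled product contains conjugates, so compatibility with the involution has to be
  carried from one doubling to the next.\<close>

definition cd_star_hom where
  "cd_star_hom \<delta> k \<gamma> n \<psi> \<longleftrightarrow>
     cd_hom \<delta> k \<gamma> n \<psi> \<and> (\<forall>x\<in>cd_carrier k. \<psi> (cd_conj k x) = cd_conj n (\<psi> x))"

definition cd_double_map where
  "cd_double_map \<gamma> n \<psi> e x = \<psi> (cd_fst x) + cd_mult \<gamma> n (\<psi> (cd_snd x)) e"

text \<open>Expanding \<open>(x1 + x2 e)(y1 + y2 e)\<close> gives four products. The first is
  handled by \<psi>, and conditions 1, 2, 3 turn the others into the remaining summands of the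
  doubled product; condition 4 handles the involution.\<close>

lemma cd_star_hom_double:
  assumes \<psi>: "cd_star_hom \<delta> k \<gamma> n \<psi>" and e: "e \<in> cd_carrier n"
    and 1: "\<And>x y. x \<in> \<psi> ` cd_carrier k \<Longrightarrow> y \<in> \<psi> ` cd_carrier k \<Longrightarrow>
      cd_mult \<gamma> n x (cd_mult \<gamma> n y e) = cd_mult \<gamma> n (cd_mult \<gamma> n y x) e"
    and 2: "\<And>x y. x \<in> \<psi> ` cd_carrier k \<Longrightarrow> y \<in> \<psi> ` cd_carrier k \<Longrightarrow>
      cd_mult \<gamma> n (cd_mult \<gamma> n x e) y = cd_mult \<gamma> n (cd_mult \<gamma> n x (cd_conj n y)) e"
    and 3: "\<And>x y. x \<in> \<psi> ` cd_carrier k \<Longrightarrow> y \<in> \<psi> ` cd_carrier k \<Longrightarrow>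
      cd_mult \<gamma> n (cd_mult \<gamma> n x e) (cd_mult \<gamma> n y e) = \<delta> k *\<^sub>R cd_mult \<gamma> n (cd_conj n y) x"
    and 4: "\<And>x. x \<in> \<psi> ` cd_carrier k \<Longrightarrow> cd_conj n (cd_mult \<gamma> n x e) = - cd_mult \<gamma> n x e"
  shows "cd_star_hom \<delta> (Suc k) \<gamma> n (cd_double_map \<gamma> n \<psi> e)"
proof -
  have add: "\<psi> (x + y) = \<psi> x + \<psi> y" and mult: "\<psi> (cd_mult \<delta> k x y) = cd_mult \<gamma> n (\<psi> x) (\<psi> y)"
    and scaleR: "\<psi> (r *\<^sub>R x) = r *\<^sub>R \<psi> x" and conj: "\<psi> (cd_conj k x) = cd_conj n (\<psi> x)"
    and carrier: "\<psi> x \<in> cd_carrier n"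
    if "x \<in> cd_carrier k" "y \<in> cd_carrier k" for x y r
    using \<psi> that by (auto simp: cd_star_hom_def cd_hom_def)
  have minus: "\<psi> (- x) = - \<psi> x" if "x \<in> cd_carrier k" for x
    using scaleR[OF that that, of "-1"] by simp
  have zero: "\<psi> 0 = 0"
    using scaleR[OF cd_zero_carrier cd_zero_carrier, of 0] by simp
  have one: "\<psi> cd_one = cd_one"
    using \<psi> by (simp add: cd_star_hom_def cd_hom_def)
  note closed = cd_mult_carrier cd_conj_carrier cd_carrier_add cd_carrier_scaleR cd_carrier_minus
  have "cd_double_map \<gamma> n \<psi> e ` cd_carrier (Suc k) \<subseteq> cd_carrier n"
    using e by (auto simp: cd_carrier_Suc_iff cd_double_map_def closed carrier simp del: cd_carrier.simps)
  then show ?thesis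
    unfolding cd_star_hom_def cd_hom_def
    by (auto simp: cd_carrier_Suc_iff cd_double_map_def Let_def cd_linear add mult scaleR conj zero one
        minus 1 2 3 4 closed scaleR_add_right add_ac simp del: cd_carrier.simps)
qed

text \<open>Tracks generators through the doublings. Right multiplication by \<open>e\<close> is
  linear, so the image is a sum of two spans.\<close>

lemma cd_double_map_image:
  assumes "\<psi> ` cd_carrier k = span B"
  shows "cd_double_map \<gamma> n \<psi> e ` cd_carrier (Suc k) = span (B \<union> (\<lambda>x. cd_mult \<gamma> n x e) ` B)"
proof -
  have "linear (\<lambda>x. cd_mult \<gamma> n x e)"
    by (rule linearI) (simp_all add: cd_mult_add_left cd_mult_scaleR_left)
  then have "span ((\<lambda>x. cd_mult \<gamma> n x e) ` B) = (\<lambda>x. cd_mult \<gamma> n x e) ` \<psi> ` cd_carrier k"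
    using assms by (simp add: linear_span_image)
  then have "span (B \<union> (\<lambda>x. cd_mult \<gamma> n x e) ` B) =
      {u + v |u v. u \<in> \<psi> ` cd_carrier k \<and> v \<in> (\<lambda>x. cd_mult \<gamma> n x e) ` \<psi> ` cd_carrier k}"
    using assms by (simp add: span_Un)
  also have "\<dots> = cd_double_map \<gamma> n \<psi> e ` cd_carrier (Suc k)"
    by (fastforce simp: cd_double_map_def image_iff)
  finally show ?thesis by simp
qed

lemma cd_star_hom_scalar:
  "cd_star_hom \<delta> 0 \<gamma> n (\<lambda>x. x 0 *\<^sub>R cd_one)"
  "(\<lambda>x. x 0 *\<^sub>R cd_one) ` cd_carrier 0 = span {cd_one}"
proof -
  show "cd_star_hom \<delta> 0 \<gamma> n (\<lambda>x. x 0 *\<^sub>R cd_one)"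
    by (auto simp: cd_star_hom_def cd_hom_def cd_linear cd_mult_one cd_one_carrier
        cd_carrier_scaleR scaleR_add_left)
  show "(\<lambda>x. x 0 *\<^sub>R cd_one) ` cd_carrier 0 = span {cd_one}"
    by (auto simp: span_singleton image_image)
qed

section \<open>Multiplication by (0, 1)\<close>

lemma cd_tilde_one_carrier: "cd_tilde_one \<in> cd_carrier (Suc m)"
  by (simp add: cd_tilde_one_def cd_carrier_Suc_iff cd_zero_carrier cd_one_carrier
      del: cd_carrier.simps)

lemma cd_mult_tilde_one:
  assumes "x \<in> cd_carrier (Suc m)"
  shows "cd_mult \<gamma> (Suc m) x cd_tilde_one = cd_pair (\<gamma> m *\<^sub>R cd_snd x) (cd_fst x)"
  using assms
  by (simp add: cd_tilde_one_def Let_def cd_carrier_Suc_iff cd_mult_one del: cd_carrier.simps)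

text \<open>These are conditions 1 to 3 of \<open>cd_star_hom_double\<close> for
  \<open>e = (0, 1)\<close>. In components, the first reduces to the exchange identity
  \<open>P\<close> and the third to its variant \<open>P'\<close>.\<close>

lemma cd_tilde_rules:
  assumes x: "x \<in> cd_carrier (Suc m)" and y: "y \<in> cd_carrier (Suc m)"
    and x0: "cd_snd x 0 = 0" and y0: "cd_snd y 0 = 0"
    and xy0: "cd_snd (cd_mult \<gamma> (Suc m) x y) 0 = 0"
  shows "cd_mult \<gamma> (Suc m) x (cd_mult \<gamma> (Suc m) y cd_tilde_one) =
      cd_mult \<gamma> (Suc m) (cd_mult \<gamma> (Suc m) y x) cd_tilde_one"
    and "cd_mult \<gamma> (Suc m) (cd_mult \<gamma> (Suc m) x cd_tilde_one) y =
      cd_mult \<gamma> (Suc m) (cd_mult \<gamma> (Suc m) x (cd_conj (Suc m) y)) cd_tilde_one"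
    and "cd_mult \<gamma> (Suc m) (cd_mult \<gamma> (Suc m) x cd_tilde_one) (cd_mult \<gamma> (Suc m) y cd_tilde_one) =
      \<gamma> m *\<^sub>R cd_mult \<gamma> (Suc m) (cd_conj (Suc m) y) x"
proof -
  let ?m = "cd_mult \<gamma> m" and ?c = "cd_conj m"
  define x1 x2 y1 y2 where d: "x1 = cd_fst x" "x2 = cd_snd x" "y1 = cd_fst y" "y2 = cd_snd y"
  have carr: "x1 \<in> cd_carrier m" "x2 \<in> cd_carrier m" "y1 \<in> cd_carrier m" "y2 \<in> cd_carrier m"
    using x y by (simp_all add: d cd_carrier_Suc_iff del: cd_carrier.simps)
  have pure: "?c x2 = - x2" "?c y2 = - y2"
    using carr x0 y0 by (simp_all add: d cd_conj_pure)
  \<comment> \<open>This is the second component of \<open>xy\<close> with the factors of both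
    products swapped. It has the same real part, hence is pure, and conjugating it yields
    \<open>P\<close>.\<close>
  let ?w = "?m x1 y2 + ?m (?c y1) x2"
  have "?w 0 = 0"
    using xy0 cd_mult_at_0_commute[of \<gamma> m]
    by (simp add: Let_def flip: d)
  then have "?c ?w = - ?w"
    using carr by (intro cd_conj_pure cd_carrier_add cd_mult_carrier cd_conj_carrier)
  moreover have "?c ?w = - (?m x2 y1 + ?m y2 (?c x1))"
    by (simp add: cd_linear cd_conj_mult pure)
  ultimately have P: "?w = ?m x2 y1 + ?m y2 (?c x1)"
    by (simp only: neg_equal_iff_equal)
  \<comment> \<open>The scalar \<open>y1\<close> plus its conjugate commutes with \<open>x2\<close>;
    subtracting \<open>P\<close> from this gives \<open>P'\<close>.\<close>
  have t: "?m y1 x2 + ?m (?c y1) x2 = ?m x2 y1 + ?m x2 (?c y1)"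
    using cd_add_conj[OF carr(3)] cd_mult_one[OF carr(2)]
    by (metis cd_mult_add_left cd_mult_add_right cd_mult_scaleR_left cd_mult_scaleR_right)
  have "?m y1 x2 - ?m x1 y2 = (?m y1 x2 + ?m (?c y1) x2) - ?w"
    by simp
  also have "\<dots> = ?m x2 (?c y1) - ?m y2 (?c x1)"
    by (simp only: P t) simp
  finally have P': "\<gamma> m *\<^sub>R ?m y1 x2 - \<gamma> m *\<^sub>R ?m x1 y2 =
      \<gamma> m *\<^sub>R ?m x2 (?c y1) - \<gamma> m *\<^sub>R ?m y2 (?c x1)"
    by (simp only: flip: scaleR_diff_right)
  note tilde = cd_mult_tilde_one cd_mult_carrier cd_conj_carrier x y
  show "cd_mult \<gamma> (Suc m) x (cd_mult \<gamma> (Suc m) y cd_tilde_one) =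
      cd_mult \<gamma> (Suc m) (cd_mult \<gamma> (Suc m) y x) cd_tilde_one"
    using P by (simp only: tilde)
      (simp add: Let_def cd_linear pure flip: d scaleR_add_right)
  show "cd_mult \<gamma> (Suc m) (cd_mult \<gamma> (Suc m) x cd_tilde_one) y =
      cd_mult \<gamma> (Suc m) (cd_mult \<gamma> (Suc m) x (cd_conj (Suc m) y)) cd_tilde_one"
    by (simp only: tilde)
      (simp add: Let_def cd_linear pure algebra_simps flip: d)
  show "cd_mult \<gamma> (Suc m) (cd_mult \<gamma> (Suc m) x cd_tilde_one) (cd_mult \<gamma> (Suc m) y cd_tilde_one) =
      \<gamma> m *\<^sub>R cd_mult \<gamma> (Suc m) (cd_conj (Suc m) y) x"
    using P' by (simp only: tilde)
      (simp add: Let_def cd_linear pure algebra_simps cd_pair_scaleR flip: d)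
qed

lemma cd_conj_tilde:
  assumes "x \<in> cd_carrier (Suc m)" "cd_snd x 0 = 0"
  shows "cd_conj (Suc m) (cd_mult \<gamma> (Suc m) x cd_tilde_one) = - cd_mult \<gamma> (Suc m) x cd_tilde_one"
proof -
  have "cd_conj m (cd_snd x) = - cd_snd x"
    using assms by (simp add: cd_carrier_Suc_iff cd_conj_pure del: cd_carrier.simps)
  then show ?thesis
    by (simp only: cd_mult_tilde_one[OF assms(1)] cd_conj_pair cd_linear cd_pair_minus)
       (simp add: scaleR_minus_right)
qed

section \<open>The multiplication table of a and b, and the three doublings\<close>

lemma span_pairE:
  assumes "x \<in> span {u, v}"
  obtains r s where "x = r *\<^sub>R u + s *\<^sub>R v"
proof -
  obtain r where "x - r *\<^sub>R u \<in> span {v}"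
    using assms by (auto simp: span_insert)
  then obtain s where "x - r *\<^sub>R u = s *\<^sub>R v"
    by (auto simp: span_singleton)
  then have "x = r *\<^sub>R u + s *\<^sub>R v"
    by (simp add: diff_eq_eq add.commute)
  then show ?thesis by (rule that)
qed

lemma cd_doubly_pureD:
  assumes "cd_doubly_pure (Suc m) x"
  shows "x \<in> cd_carrier (Suc m)" "x 0 = 0" "cd_snd x 0 = 0"
proof -
  obtain x1 x2 where x: "x1 \<in> cd_carrier m" "x2 \<in> cd_carrier m" "x = cd_pair x1 x2"
    "cd_Re m x1 = 0" "cd_Re m x2 = 0"
    using assms by (auto simp: cd_doubly_pure_def)
  then show "x \<in> cd_carrier (Suc m)" by auto
  have "cd_Re m z 0 = z 0" for z
    by (simp add: cd_Re_def)
  then show "x 0 = 0" "cd_snd x 0 = 0"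
    using x by (metis cd_at_0(2) cd_pair_at_0, metis cd_at_0(2) cd_snd_pair)
qed

theorem lemma5p8:
  fixes \<gamma> :: "nat \<Rightarrow> real" and n :: nat and a b :: cd
  assumes "\<And>k. k < n \<Longrightarrow> \<gamma> k \<noteq> 0"
    and "n \<ge> 1"
    and "a \<in> cd_carrier n" and "b \<in> cd_carrier n"
    and "cd_doubly_pure n a" and "cd_doubly_pure n b"
    and "\<forall>x \<in> span {cd_one, a, cd_tilde_one, cd_tilde \<gamma> n a}. cd_inner \<gamma> n b x = 0"
    and "alternate_strongly \<gamma> n a b"
  shows "(\<exists>\<phi>. cd_hom ((!) [- cd_n \<gamma> n a, - cd_n \<gamma> n b, \<gamma> (n - 1)]) 3 \<gamma> n \<phi> \<and>
              \<phi> ` cd_carrier 3 = cd_O \<gamma> n a b) \<and>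
         cd_subalgebra \<gamma> n (cd_O \<gamma> n a b) \<and>
         cd_alternative_on \<gamma> n (cd_O \<gamma> n a b)"
proof -
  obtain m where n: "n = Suc m"
    using \<open>n \<ge> 1\<close> by (cases n) auto
  \<comment> \<open>As \<open>a\<close> and \<open>b\<close> are pure, these are the scalars equal
    to their squares (\<open>aa\<close>, \<open>bb\<close> below).\<close>
  define \<alpha> \<beta> where "\<alpha> = - cd_n \<gamma> n a" and "\<beta> = - cd_n \<gamma> n b"
  define \<delta> where "\<delta> = (!) [\<alpha>, \<beta>, \<gamma> (n - 1)]"
  have \<delta>: "\<delta> 0 = \<alpha>" "\<delta> (Suc 0) = \<beta>" "\<delta> (Suc (Suc 0)) = \<gamma> m"
    by (simp_all add: \<delta>_def n)
  let ?m = "cd_mult \<gamma> n" and ?c = "cd_conj n"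
  define c where "c = ?m a b"
  note carrier = \<open>a \<in> cd_carrier n\<close> \<open>b \<in> cd_carrier n\<close>
  have carrier': "c \<in> cd_carrier n" "cd_tilde_one \<in> cd_carrier n"
    unfolding c_def n using carrier n by (simp_all only: cd_mult_carrier cd_tilde_one_carrier)
  have a0: "a 0 = 0" "cd_snd a 0 = 0" and b0: "b 0 = 0" "cd_snd b 0 = 0"
    using cd_doubly_pureD assms n by auto
  have ca: "?c a = - a" and cb: "?c b = - b"
    using a0 b0 carrier by (simp_all add: cd_conj_pure)

  have orth: "?m b (?c x) + ?m x (?c b) = 0" if "x \<in> {a, ?m a cd_tilde_one}" for x
  proof -
    have "cd_inner \<gamma> n b x = 0"
      using that assms(7) by (auto simp: cd_tilde_def intro: span_base)
    then show ?thesis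
      by (simp add: cd_inner_def del: cd_mult.simps)
  qed
  have "?m b a + ?m a b = 0"
    using orth[of a] by (simp add: ca cb cd_mult_minus) (metis add.commute add_eq_0_iff)
  then have ba: "?m b a = - c"
    by (simp add: c_def eq_neg_iff_add_eq_0)
  have cc: "?c c = - c"
    by (simp add: c_def cd_conj_mult ca cb cd_linear ba[unfolded c_def])
  have aa: "?m a a = \<alpha> *\<^sub>R cd_one" and bb: "?m b b = \<beta> *\<^sub>R cd_one"
    using ca cb by (simp_all add: \<alpha>_def \<beta>_def cd_mult_self_pure)
  \<comment> \<open>Strong alternativity gives \<open>a(ab) = (aa)b\<close> and
    \<open>b(ba) = (bb)a\<close>; conjugating these two products then yields \<open>ca\<close> and
    \<open>cb\<close>.\<close>
  have ac: "?m a c = \<alpha> *\<^sub>R b"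
    using assms(8) carrier
    by (simp add: alternate_strongly_def c_def[symmetric] aa cd_linear cd_mult_one)
  have bc: "?m b c = - \<beta> *\<^sub>R a"
    using assms(8) carrier
    by (simp add: alternate_strongly_def ba bb cd_linear cd_mult_one minus_equation_iff)
  have ca': "?m c a = - \<alpha> *\<^sub>R b"
    using arg_cong[OF ac, of ?c] by (simp add: cd_conj_mult cd_linear ca cb cc)
  have cb': "?m c b = \<beta> *\<^sub>R a"
    using arg_cong[OF bc, of ?c] by (simp add: cd_conj_mult cd_linear ca cb cc)
  have "?m c c = - cd_n \<gamma> n c *\<^sub>R cd_one"
    using cc by (rule cd_mult_self_pure)
  \<comment> \<open>\<open>cc\<close> is already known to be scalar, so its real part determines it;
    the trace property replaces \<open>(ab)c\<close> by \<open>a(bc)\<close>.\<close>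
  moreover have "?m c c 0 = - (\<alpha> * \<beta>)"
    using cd_mult_at_0_assoc[of \<gamma> n a b c]
    by (simp add: c_def[symmetric] bc cd_linear aa)
  ultimately have cc': "?m c c = - (\<alpha> * \<beta>) *\<^sub>R cd_one"
    by simp
  \<comment> \<open>The two summands in \<open>orth\<close> are conjugates of each other, so each
    has real part zero. By the trace property \<open>c\<close> times (0, 1) has real part zero, and
    that real part is \<open>\<gamma> m * cd_snd c 0\<close> with \<open>\<gamma> m\<close>
    nonzero.\<close>
  have c0: "cd_snd c 0 = 0"
  proof -
    let ?t = "?m a cd_tilde_one"
    have "?m ?t (?c b) = ?c (?m b (?c ?t))"
      by (simp add: cd_conj_mult)
    then have "?m b (?c ?t) 0 = 0"
      using arg_cong[OF orth[of ?t], of "\<lambda>x. x 0"] by simp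
    moreover have "?c ?t = - ?t"
      unfolding n using cd_conj_tilde a0 carrier n by simp
    ultimately have "?m (?m b a) cd_tilde_one 0 = 0"
      by (simp add: cd_mult_minus cd_mult_at_0_assoc)
    then have "?m c cd_tilde_one 0 = 0"
      by (simp add: ba cd_mult_minus)
    moreover have "?m c cd_tilde_one = cd_pair (\<gamma> m *\<^sub>R cd_snd c) (cd_fst c)"
      using carrier'(1) unfolding n by (rule cd_mult_tilde_one)
    ultimately have "\<gamma> m * cd_snd c 0 = 0"
      by simp
    then show ?thesis
      using assms(1)[of m] n by simp
  qed

  define \<psi>0 \<psi>1 \<psi>2 \<phi> where "\<psi>0 = (\<lambda>x::cd. x 0 *\<^sub>R cd_one)" and "\<psi>1 = cd_double_map \<gamma> n \<psi>0 a"
    and "\<psi>2 = cd_double_map \<gamma> n \<psi>1 b" and "\<phi> = cd_double_map \<gamma> n \<psi>2 cd_tilde_one"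
  have hom0: "cd_star_hom \<delta> 0 \<gamma> n \<psi>0" and im0: "\<psi>0 ` cd_carrier 0 = span {cd_one}"
    unfolding \<psi>0_def by (rule cd_star_hom_scalar)+

  have hom1: "cd_star_hom \<delta> (Suc 0) \<gamma> n \<psi>1"
    unfolding \<psi>1_def
    by (rule cd_star_hom_double[OF hom0 carrier(1)])
       (auto simp: im0 span_singleton cd_linear cd_mult_one carrier cd_one_carrier \<delta> aa ca
         simp del: cd_carrier.simps)
  have im1: "\<psi>1 ` cd_carrier (Suc 0) = span {cd_one, a}"
    unfolding \<psi>1_def cd_double_map_image[OF im0] using carrier
    by (simp add: cd_mult_one insert_commute)

  \<comment> \<open>Elements of the image of \<open>\<psi>1\<close> are combinations of
    \<open>cd_one\<close> and \<open>a\<close>, so bilinearity reduces all four conditions to the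
    multiplication table.\<close>
  have hom2: "cd_star_hom \<delta> (Suc (Suc 0)) \<gamma> n \<psi>2"
    unfolding \<psi>2_def
    by (rule cd_star_hom_double[OF hom1 carrier(2)])
       (auto simp: im1 elim!: span_pairE simp: cd_linear cd_mult_diff_left cd_mult_diff_right cd_mult_one carrier carrier' cd_one_carrier
         \<delta> aa bb ac bc ca cb cc ca' cb' cc' ba c_def[symmetric] algebra_simps simp del: cd_carrier.simps)
  have im2: "\<psi>2 ` cd_carrier (Suc (Suc 0)) = span {cd_one, a, b, c}"
    unfolding \<psi>2_def cd_double_map_image[OF im1] using carrier
    by (simp add: cd_mult_one c_def insert_commute)

  \<comment> \<open>Closure under products ensures that \<open>xy\<close> also has a pure second
    component, as \<open>cd_tilde_rules\<close> requires.\<close>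
  have sub: "cd_subalgebra \<gamma> n (span {cd_one, a, b, c})"
    using cd_hom_image_subalgebra hom2 im2 by (metis cd_star_hom_def)
  have "subspace {x. cd_snd x 0 = 0}"
    by (simp add: subspace_def)
  then have "span {cd_one, a, b, c} \<subseteq> {x. cd_snd x 0 = 0}"
    using a0 b0 c0 by (intro span_minimal) auto
  then have H: "x \<in> cd_carrier (Suc m)" "cd_snd x 0 = 0" "cd_snd (cd_mult \<gamma> (Suc m) x y) 0 = 0"
    if "x \<in> span {cd_one, a, b, c}" "y \<in> span {cd_one, a, b, c}" for x y
    using that sub n by (auto simp: cd_subalgebra_def simp del: cd_mult.simps cd_carrier.simps)
  have "cd_star_hom \<delta> (Suc (Suc (Suc 0))) \<gamma> n \<phi>"
    unfolding \<phi>_def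
    by (rule cd_star_hom_double[OF hom2 carrier'(2)]; unfold im2 n \<delta>)
       (intro cd_tilde_rules cd_conj_tilde; rule H; assumption)+
  then have hom: "cd_hom \<delta> 3 \<gamma> n \<phi>"
    by (simp add: cd_star_hom_def numeral_3_eq_3)
  have im: "\<phi> ` cd_carrier 3 = cd_O \<gamma> n a b"
    unfolding \<phi>_def numeral_3_eq_3 cd_double_map_image[OF im2] cd_O_def cd_tilde_def
    using carrier' by (simp add: cd_mult_one c_def insert_commute)
  show ?thesis
    using hom im cd_hom_image_subalgebra[OF hom]
      cd_hom_image_alternative[OF hom cd_alternative_on_level_3]
    unfolding \<delta>_def \<alpha>_def \<beta>_def by auto
qed

end
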